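(* Let $\mathcal{H}=\bigotimes_{i=1}^n\mathcal{H}_i$ with $\dim\mathcal{H}_i=d_i$, and set $B:=\sum_{i_1,\dots,i_n=0}^1d_1^{i_1}\cdots d_n^{i_n}$, $C:=\sum_{p|q}(d_p+d_q)$ (sum over non-trivial unordered bipartitions $p|q$ of $\{1,\dots,n\}$, with $d_p=\prod_{i\in p}d_i$), and $D:=d_1\cdots d_n$. The Haar averages of the entangling power $\epsilon_1$ of $n$-partite gates over the unitary group $U(D)$ and over the orthogonal group $O(D)$ (real orthogonal matrices in a fixed product basis) are $$\langle\epsilon_1\rangle_{U(d_1\cdots d_n)}=2\left[1-\left(\prod_{i=1}^n\frac{1}{d_i+1}\right)\frac{BC}{(2^{n-1}-1)(D+1)}\right],$$ $$\langle\epsilon_1\rangle_{O(d_1\cdots d_n)}=2\left[1-\left(\prod_{i=1}^n\frac{1}{d_i+1}\right)\frac{2^n(D+1)-2B+\frac{BD-2^n}{2^{n-1}-1}C}{(D-1)(D+2)}\right].$$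
   Context: For a pure state $|\psi\rangle\in\mathcal{H}$ and a bipartition $p|q$ of $\{1,\dots,n\}$, $\tau_{p|q}(|\psi\rangle)=2\big(1-\operatorname{tr}[(\operatorname{tr}_p|\psi\rangle\langle\psi|)^2]\big)$; the $n$-party one-tangle is $\tau_1=\frac{1}{2^{n-1}-1}\sum_{p|q}\tau_{p|q}$. The entangling power $\epsilon_1(U)$ of a unitary $U$ on $\mathcal{H}$ is the average of $\tau_1(U|\psi_{\rm sep}\rangle)$ over $|\psi_{\rm sep}\rangle=|\psi_1\rangle\otimes\cdots\otimes|\psi_n\rangle$, each $|\psi_i\rangle$ drawn independently from the unitarily invariant measure on pure states of $\mathcal{H}_i$. *)

theory Defs
  imports "HOL-Probability.Probability"
begin

definition vec_space :: "'a set \<Rightarrow> ('a \<Rightarrow> complex) measure" where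
  "vec_space A = PiM A (\<lambda>_. borel)"

definition mat_space :: "'a set \<Rightarrow> ('a \<times> 'a \<Rightarrow> complex) measure" where
  "mat_space A = PiM (A \<times> A) (\<lambda>_. borel)"

definition unit_vec :: "'a set \<Rightarrow> ('a \<Rightarrow> complex) \<Rightarrow> bool" where
  "unit_vec A v \<longleftrightarrow> (\<Sum>j\<in>A. (cmod (v j))\<^sup>2) = 1"

definition unitary_mat :: "'a set \<Rightarrow> ('a \<times> 'a \<Rightarrow> complex) \<Rightarrow> bool" where
  "unitary_mat A u \<longleftrightarrow>
     (\<forall>j\<in>A. \<forall>k\<in>A. (\<Sum>l\<in>A. cnj (u (l, j)) * u (l, k)) = (if j = k then 1 else 0)) \<and>
     (\<forall>j\<in>A. \<forall>k\<in>A. (\<Sum>l\<in>A. u (j, l) * cnj (u (k, l))) = (if j = k then 1 else 0))"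

definition orthogonal_mat :: "'a set \<Rightarrow> ('a \<times> 'a \<Rightarrow> complex) \<Rightarrow> bool" where
  "orthogonal_mat A u \<longleftrightarrow> unitary_mat A u \<and> (\<forall>j\<in>A. \<forall>k\<in>A. u (j, k) \<in> \<real>)"

definition mat_vec :: "'a set \<Rightarrow> ('a \<times> 'a \<Rightarrow> complex) \<Rightarrow> ('a \<Rightarrow> complex) \<Rightarrow> ('a \<Rightarrow> complex)" where
  "mat_vec A u v = (\<lambda>j. if j \<in> A then (\<Sum>k\<in>A. u (j, k) * v k) else undefined)"

definition mat_mult :: "'a set \<Rightarrow> ('a \<times> 'a \<Rightarrow> complex) \<Rightarrow> ('a \<times> 'a \<Rightarrow> complex) \<Rightarrow> ('a \<times> 'a \<Rightarrow> complex)" where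
  "mat_mult A u w = (\<lambda>(j, k). if j \<in> A \<and> k \<in> A then (\<Sum>l\<in>A. u (j, l) * w (l, k)) else undefined)"

definition invariant_state_measure :: "'a set \<Rightarrow> ('a \<Rightarrow> complex) measure \<Rightarrow> bool" where
  "invariant_state_measure A \<nu> \<longleftrightarrow>
     prob_space \<nu> \<and> sets \<nu> = sets (vec_space A) \<and> (AE v in \<nu>. unit_vec A v) \<and>
     (\<forall>u. unitary_mat A u \<longrightarrow> distr \<nu> (vec_space A) (mat_vec A u) = \<nu>)"

definition haar_unitary :: "'a set \<Rightarrow> ('a \<times> 'a \<Rightarrow> complex) measure \<Rightarrow> bool" where
  "haar_unitary A \<mu> \<longleftrightarrow>
     prob_space \<mu> \<and> sets \<mu> = sets (mat_space A) \<and> (AE u in \<mu>. unitary_mat A u) \<and>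
     (\<forall>v. unitary_mat A v \<longrightarrow> distr \<mu> (mat_space A) (mat_mult A v) = \<mu>)"

definition haar_orthogonal :: "'a set \<Rightarrow> ('a \<times> 'a \<Rightarrow> complex) measure \<Rightarrow> bool" where
  "haar_orthogonal A \<mu> \<longleftrightarrow>
     prob_space \<mu> \<and> sets \<mu> = sets (mat_space A) \<and> (AE u in \<mu>. orthogonal_mat A u) \<and>
     (\<forall>v. orthogonal_mat A v \<longrightarrow> distr \<mu> (mat_space A) (mat_mult A v) = \<mu>)"

text \<open>Product basis of H = H_0 (x) ... (x) H_(n-1): tuples j with j i < d i.\<close>
definition idx :: "(nat \<Rightarrow> nat) \<Rightarrow> nat set \<Rightarrow> (nat \<Rightarrow> nat) set" where
  "idx d S = PiE S (\<lambda>i. {..<d i})"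

definition tensor :: "(nat \<Rightarrow> nat) \<Rightarrow> nat \<Rightarrow> (nat \<Rightarrow> nat \<Rightarrow> complex) \<Rightarrow> ((nat \<Rightarrow> nat) \<Rightarrow> complex)" where
  "tensor d n \<psi> = (\<lambda>j. if j \<in> idx d {..<n} then (\<Prod>i<n. \<psi> i (j i)) else undefined)"

definition merge_idx :: "nat set \<Rightarrow> (nat \<Rightarrow> nat) \<Rightarrow> (nat \<Rightarrow> nat) \<Rightarrow> (nat \<Rightarrow> nat)" where
  "merge_idx p x y = (\<lambda>i. if i \<in> p then x i else y i)"

text \<open>Matrix entries of tr_p |psi><psi| (an operator on the parties q = complement of p).\<close>
definition reduced_density ::
  "(nat \<Rightarrow> nat) \<Rightarrow> nat \<Rightarrow> nat set \<Rightarrow> ((nat \<Rightarrow> nat) \<Rightarrow> complex) \<Rightarrow> (nat \<Rightarrow> nat) \<Rightarrow> (nat \<Rightarrow> nat) \<Rightarrow> complex" where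
  "reduced_density d n p \<psi> y y' =
     (\<Sum>x\<in>idx d p. \<psi> (merge_idx p x y) * cnj (\<psi> (merge_idx p x y')))"

definition purity :: "(nat \<Rightarrow> nat) \<Rightarrow> nat \<Rightarrow> nat set \<Rightarrow> ((nat \<Rightarrow> nat) \<Rightarrow> complex) \<Rightarrow> real" where
  "purity d n p \<psi> =
     Re (\<Sum>y\<in>idx d ({..<n} - p). \<Sum>y'\<in>idx d ({..<n} - p).
           reduced_density d n p \<psi> y y' * reduced_density d n p \<psi> y' y)"

definition tau :: "(nat \<Rightarrow> nat) \<Rightarrow> nat \<Rightarrow> nat set \<Rightarrow> ((nat \<Rightarrow> nat) \<Rightarrow> complex) \<Rightarrow> real" where
  "tau d n p \<psi> = 2 * (1 - purity d n p \<psi>)"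

text \<open>Non-trivial unordered bipartitions p|q of {0..n-1}, each represented by the part p containing 0.\<close>
definition bipartitions :: "nat \<Rightarrow> nat set set" where
  "bipartitions n = {p. p \<subseteq> {..<n} \<and> 0 \<in> p \<and> p \<noteq> {..<n}}"

definition one_tangle :: "(nat \<Rightarrow> nat) \<Rightarrow> nat \<Rightarrow> ((nat \<Rightarrow> nat) \<Rightarrow> complex) \<Rightarrow> real" where
  "one_tangle d n \<psi> = (1 / (2 ^ (n - 1) - 1)) * (\<Sum>p\<in>bipartitions n. tau d n p \<psi>)"

definition entangling_power ::
  "(nat \<Rightarrow> nat) \<Rightarrow> nat \<Rightarrow> (nat \<Rightarrow> (nat \<Rightarrow> complex) measure) \<Rightarrow> ((nat \<Rightarrow> nat) \<times> (nat \<Rightarrow> nat) \<Rightarrow> complex) \<Rightarrow> real" where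
  "entangling_power d n \<nu> U =
     (\<integral>\<psi>. one_tangle d n (mat_vec (idx d {..<n}) U (tensor d n \<psi>)) \<partial>(PiM {..<n} \<nu>))"

definition dprod :: "(nat \<Rightarrow> nat) \<Rightarrow> nat set \<Rightarrow> real" where
  "dprod d S = (\<Prod>i\<in>S. real (d i))"

definition constB :: "(nat \<Rightarrow> nat) \<Rightarrow> nat \<Rightarrow> real" where
  "constB d n = (\<Sum>S\<in>Pow {..<n}. dprod d S)"

definition constC :: "(nat \<Rightarrow> nat) \<Rightarrow> nat \<Rightarrow> real" where
  "constC d n = (\<Sum>p\<in>bipartitions n. dprod d p + dprod d ({..<n} - p))"

definition constD :: "(nat \<Rightarrow> nat) \<Rightarrow> nat \<Rightarrow> real" where
  "constD d n = dprod d {..<n}"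

end

theory Submission
  imports Defs
begin

text \<open>
  For a Haar gate \<open>U\<close> and a random product state \<open>v\<close> the law of \<open>w = U v\<close> is invariant under real
  orthogonal matrices. Reflections in coordinate planes then force
  \<open>E (w\<^sub>a w\<^sub>b\<^sup>* w\<^sub>c w\<^sub>e\<^sup>*) = \<alpha> (\<delta>\<^sub>a\<^sub>b \<delta>\<^sub>c\<^sub>e + \<delta>\<^sub>a\<^sub>e \<delta>\<^sub>b\<^sub>c) + \<gamma> \<delta>\<^sub>a\<^sub>c \<delta>\<^sub>b\<^sub>e\<close>, where \<open>\<alpha>\<close> and \<open>\<gamma>\<close> are determined by the
  dimension \<open>D\<close> and by \<open>s = E \<bar>\<Sum>\<^sub>a w\<^sub>a\<^sup>2\<bar>\<^sup>2\<close>, and the expected purity across \<open>p|q\<close> is \<open>D (\<alpha> (d\<^sub>p + d\<^sub>q) + \<gamma>)\<close>.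
  In the unitary case phases give \<open>\<gamma> = 0\<close>, i.e. \<open>s = 2 / (D + 1)\<close>. In the orthogonal case \<open>s\<close> is the
  same for \<open>w\<close> and for the product state \<open>v\<close>, where it factorises into the one-party values
  \<open>2 / (d\<^sub>i + 1)\<close>, which are again instances of the unitary case. Finally \<open>B\<close> is the product of the \<open>d\<^sub>i + 1\<close>.
\<close>

section \<open>Fourth moments of an orthogonally invariant unit vector\<close>

text \<open>On the plane of coordinates \<open>a\<close>, \<open>c\<close> this is the block with
  rows (x, y) and (cnj y, - cnj x), of determinant -1 when |x|^2 + |y|^2 = 1. This single family
  contains every symmetry needed below: (-1, 0) flips a sign, (0, 1) swaps two coordinates, equal
  real entries mix them at 45 degrees, and y = 0 gives phases.\<close>

definition plane_mat :: "'a \<Rightarrow> 'a \<Rightarrow> complex \<Rightarrow> complex \<Rightarrow> 'a \<times> 'a \<Rightarrow> complex" where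
  "plane_mat a c x y = (\<lambda>(j, k).
     if j = a then (if k = a then x else if k = c then y else 0)
     else if j = c then (if k = a then cnj y else if k = c then - cnj x else 0)
     else if j = k then 1 else 0)"

lemma sum_plane_mat:
  assumes "finite A" "a \<in> A" "c \<in> A" "a \<noteq> c" "j \<in> A"
  shows "(\<Sum>k\<in>A. plane_mat a c x y (j, k) * v k) =
    (if j = a then x * v a + y * v c else if j = c then cnj y * v a - cnj x * v c else v j)"
proof -
  have eq: "A = insert a (insert c (A - {a, c}))" using assms by auto
  have rest: "(\<Sum>k\<in>A - {a, c}. plane_mat a c x y (j, k) * v k) = (if j = a \<or> j = c then 0 else v j)"
  proof (cases "j = a \<or> j = c")
    case True
    then show ?thesis by (intro trans[OF sum.neutral]) (auto simp: plane_mat_def)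
  next
    case False
    have "(\<Sum>k\<in>A - {a, c}. plane_mat a c x y (j, k) * v k) = (\<Sum>k\<in>A - {a, c}. if j = k then v k else 0)"
      using False by (intro sum.cong) (auto simp: plane_mat_def)
    then show ?thesis using False assms by simp
  qed
  have "(\<Sum>k\<in>A. plane_mat a c x y (j, k) * v k) =
      plane_mat a c x y (j, a) * v a + (plane_mat a c x y (j, c) * v c +
      (\<Sum>k\<in>A - {a, c}. plane_mat a c x y (j, k) * v k))"
    using assms by (subst eq) simp
  then show ?thesis unfolding rest using assms(4) by (auto simp: plane_mat_def)
qed

text \<open>Passing to the adjoint only replaces \<open>x\<close> by \<open>cnj x\<close>, so the
  family is closed under adjoints and the single product identity \<open>key\<close> yields both
  unitarity conditions.\<close>

lemma unitary_plane_mat: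
  assumes "finite A" "a \<in> A" "c \<in> A" "a \<noteq> c" and xy: "(cmod x)\<^sup>2 + (cmod y)\<^sup>2 = 1"
  shows "unitary_mat A (plane_mat a c x y)"
proof -
  have xy': "x * cnj x + y * cnj y = 1"
    by (simp only: complex_norm_square[symmetric] of_real_add[symmetric] xy of_real_1)
  have adj: "cnj (plane_mat a c x y (l, j)) = plane_mat a c (cnj x) y (j, l)" for l j
    using assms(4) by (auto simp: plane_mat_def)
  have key: "(\<Sum>l\<in>A. plane_mat a c x y (j, l) * plane_mat a c (cnj x) y (l, k)) = (if j = k then 1 else 0)"
    if "x * cnj x + y * cnj y = 1" "j \<in> A" "k \<in> A" for j k x
  proof -
    consider "j = a" | "j = c" | "j \<noteq> a" "j \<noteq> c" by blast
    then show ?thesis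
      unfolding sum_plane_mat[OF assms(1-4) that(2)] using that(1) assms(4)
      by cases (simp_all add: plane_mat_def algebra_simps)
  qed
  have "(\<Sum>l\<in>A. cnj (plane_mat a c x y (l, j)) * plane_mat a c x y (l, k)) = (if j = k then 1 else 0)"
    if "j \<in> A" "k \<in> A" for j k
    using key[of "cnj x" j k] that xy' unfolding adj by (simp add: mult.commute)
  moreover have "(\<Sum>l\<in>A. plane_mat a c x y (j, l) * cnj (plane_mat a c x y (k, l))) = (if j = k then 1 else 0)"
    if "j \<in> A" "k \<in> A" for j k
    using key[OF xy' that] unfolding adj .
  ultimately show ?thesis unfolding unitary_mat_def by blast
qed

lemma orthogonal_plane_mat:
  assumes "finite A" "a \<in> A" "c \<in> A" "a \<noteq> c" and "x\<^sup>2 + y\<^sup>2 = 1"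
  shows "orthogonal_mat A (plane_mat a c (complex_of_real x) (complex_of_real y))"
  using unitary_plane_mat[OF assms(1-4), of "of_real x" "of_real y"] assms(5)
  by (auto simp: orthogonal_mat_def plane_mat_def)

section \<open>Measurability and boundedness of coordinates\<close>

lemma borel_measurable_cnj [measurable (raw)]:
  "f \<in> borel_measurable M \<Longrightarrow> (\<lambda>x. cnj (f x)) \<in> borel_measurable M"
  by (rule borel_measurable_continuous_on[OF continuous_on_cnj[OF continuous_on_id]])

lemma mat_vec_measurable [measurable]: "mat_vec A u \<in> measurable (vec_space A) (vec_space A)"
proof -
  have "mat_vec A u = (\<lambda>v. \<lambda>j\<in>A. \<Sum>k\<in>A. u (j, k) * v k)"
    by (simp add: mat_vec_def restrict_def fun_eq_iff)
  then show ?thesis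
    unfolding vec_space_def
    by (auto intro!: measurable_restrict borel_measurable_sum borel_measurable_times)
qed

lemma unit_vec_cmod_le:
  assumes "finite A" "unit_vec A v" "a \<in> A"
  shows "cmod (v a) \<le> 1"
proof -
  have "(cmod (v a))\<^sup>2 \<le> (\<Sum>j\<in>A. (cmod (v j))\<^sup>2)"
    using assms by (intro member_le_sum) auto
  then show ?thesis using assms(2) by (simp add: unit_vec_def power_le_one_iff)
qed

text \<open>Invariance is required only under real orthogonal matrices, so that outputs of unitary
  gates, outputs of orthogonal gates and the one-party states are all instances.\<close>

locale orthogonal_law = prob_space \<rho> for A :: "'a set" and \<rho> :: "('a \<Rightarrow> complex) measure" +
  assumes finA: "finite A" and cardA: "card A \<ge> 2"
    and sets_law: "sets \<rho> = sets (vec_space A)"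
    and AE_unit: "AE w in \<rho>. unit_vec A w"
    and law_invariant: "orthogonal_mat A u \<Longrightarrow> distr \<rho> (vec_space A) (mat_vec A u) = \<rho>"
begin

section \<open>Fourth moments and their symmetries\<close>

definition moment :: "'a \<Rightarrow> 'a \<Rightarrow> 'a \<Rightarrow> 'a \<Rightarrow> complex" where
  "moment a b c e = (\<integral>w. w a * cnj (w b) * w c * cnj (w e) \<partial>\<rho>)"

lemma component_measurable [measurable]: "a \<in> A \<Longrightarrow> (\<lambda>w. w a) \<in> borel_measurable \<rho>"
  using measurable_cong_sets[OF sets_law refl]
  by (auto simp: vec_space_def intro: measurable_component_singleton)

lemma integrable_monomial:
  assumes [measurable]: "a \<in> A" "b \<in> A" "c \<in> A" "e \<in> A"
  shows "integrable \<rho> (\<lambda>w. w a * cnj (w b) * w c * cnj (w e))"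
proof (rule integrable_const_bound[where B = 1])
  have "cmod (w a * cnj (w b) * w c * cnj (w e)) \<le> 1" if "unit_vec A w" for w
    using unit_vec_cmod_le[OF finA that] assms by (auto simp: norm_mult intro!: mult_le_one)
  then show "AE w in \<rho>. cmod (w a * cnj (w b) * w c * cnj (w e)) \<le> 1"
    using AE_unit by auto
qed simp

lemma has_moment:
  assumes "a \<in> A" "b \<in> A" "c \<in> A" "e \<in> A"
  shows "has_bochner_integral \<rho> (\<lambda>w. w a * cnj (w b) * w c * cnj (w e)) (moment a b c e)"
  unfolding moment_def by (intro has_bochner_integral_integrable integrable_monomial assms)

lemma integral_invariant:
  fixes f :: "('a \<Rightarrow> complex) \<Rightarrow> complex"
  assumes "distr \<rho> (vec_space A) (mat_vec A u) = \<rho>" and "f \<in> borel_measurable \<rho>"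
  shows "(\<integral>w. f (mat_vec A u w) \<partial>\<rho>) = (\<integral>w. f w \<partial>\<rho>)"
proof -
  have "(\<integral>w. f (mat_vec A u w) \<partial>\<rho>) = (\<integral>w. f w \<partial>distr \<rho> (vec_space A) (mat_vec A u))"
    using assms(2) by (subst integral_distr) (simp_all add: measurable_cong_sets[OF sets_law refl])
  then show ?thesis by (simp only: assms(1))
qed

text \<open>The premise is invariance under this particular matrix, so complex \<open>x\<close> and
  \<open>y\<close> are admissible as soon as the law is unitarily invariant.\<close>

lemma moment_plane:
  assumes "distr \<rho> (vec_space A) (mat_vec A (plane_mat i k x y)) = \<rho>"
    and ik: "i \<in> A" "k \<in> A" "i \<noteq> k" and abce: "a \<in> A" "b \<in> A" "c \<in> A" "e \<in> A"
  defines "t \<equiv> \<lambda>w j. if j = i then x * w i + y * w k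
                       else if j = k then cnj y * w i - cnj x * w k else w j"
  shows "moment a b c e = (\<integral>w. t w a * cnj (t w b) * t w c * cnj (t w e) \<partial>\<rho>)"
proof -
  have "mat_vec A (plane_mat i k x y) w j = t w j" if "j \<in> A" for w j
    using that sum_plane_mat[OF finA ik that, of x y w] by (simp add: mat_vec_def t_def)
  then show ?thesis
    unfolding moment_def using abce
    by (subst integral_invariant[OF assms(1), symmetric]) simp_all
qed

lemmas moment_plane_real = moment_plane[OF law_invariant[OF orthogonal_plane_mat[OF finA]]]

lemma other_element: "a \<in> A \<Longrightarrow> \<exists>k\<in>A. k \<noteq> a"
proof (rule ccontr)
  assume "a \<in> A" "\<not> (\<exists>k\<in>A. k \<noteq> a)"
  then have "A = {a}" by blast
  then have "card A = 1" by simp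
  then show False using cardA by simp
qed

text \<open>Flip the sign of coordinate \<open>i\<close>. If \<open>i\<close> occurs an odd number
  of times among the four indices, the moment equals its own negative and vanishes.\<close>

lemma moment_sign:
  assumes "i \<in> A" "a \<in> A" "b \<in> A" "c \<in> A" "e \<in> A"
  defines "s \<equiv> \<lambda>j. if j = i then -1 else (1 :: complex)"
  shows "moment a b c e = s a * s b * s c * s e * moment a b c e"
proof -
  \<comment> \<open>\<open>k\<close> only completes the plane: for x = -1, y = 0 the matrix leaves
    coordinate \<open>k\<close> fixed.\<close>
  obtain k where k: "k \<in> A" "k \<noteq> i" using other_element assms(1) by auto
  have "moment a b c e = (\<integral>w. s a * s b * s c * s e * (w a * cnj (w b) * w c * cnj (w e)) \<partial>\<rho>)"
    by (subst moment_plane_real[of i k "-1" 0])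
       (use assms k in \<open>auto simp: s_def intro!: Bochner_Integration.integral_cong\<close>)
  then show ?thesis by (simp add: moment_def)
qed

lemma moment_swap:
  assumes "i \<in> A" "k \<in> A" "i \<noteq> k" "a \<in> A" "b \<in> A" "c \<in> A" "e \<in> A"
  defines "s \<equiv> \<lambda>j. if j = i then k else if j = k then i else j"
  shows "moment a b c e = moment (s a) (s b) (s c) (s e)"
  by (subst moment_plane_real[of i k 0 1])
     (use assms in \<open>auto simp: s_def moment_def intro!: Bochner_Integration.integral_cong\<close>)

lemma moment_commute: "moment a b c e = moment c b a e" "moment a b c e = moment a e c b"
  by (simp_all add: moment_def mult.commute mult.left_commute)

text \<open>Rotating a pair of coordinates by 45 degrees.\<close>
lemma moment_diagonal:
  assumes "a \<in> A" "c \<in> A" "a \<noteq> c"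
  shows "moment a a a a = 2 * moment a a c c + moment a c a c"
proof -
  define r :: real where "r = 1 / sqrt 2"
  let ?h = "complex_of_real r"
  have r2: "r\<^sup>2 + r\<^sup>2 = 1" by (simp add: r_def power_divide)
  have h4: "?h * ?h * ?h * ?h = 1 / 4"
    by (simp add: r_def flip: of_real_mult)
  \<comment> \<open>Among the sixteen monomials of the expansion these eight contain one index once
    and the other three times, so a sign flip kills them.\<close>
  have z: "moment a a a c = 0" "moment a a c a = 0" "moment a c a a = 0" "moment c a a a = 0"
     "moment c c c a = 0" "moment c c a c = 0" "moment c a c c = 0" "moment a c c c = 0"
    using assms moment_sign[of a a a a c] moment_sign[of a a a c a] moment_sign[of a a c a a]
      moment_sign[of a c a a a] moment_sign[of a c c c a] moment_sign[of a c c a c]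
      moment_sign[of a c a c c] moment_sign[of a a c c c] by simp_all
  have "moment a a a a = (\<integral>w. (?h * w a + ?h * w c) * cnj (?h * w a + ?h * w c) *
           (?h * w a + ?h * w c) * cnj (?h * w a + ?h * w c) \<partial>\<rho>)"
    by (subst moment_plane_real[of a c r r]) (use assms r2 in auto)
  also have "\<dots> = (\<integral>w. ?h * ?h * ?h * ?h * ((\<Sum>i\<in>{a, c}. \<Sum>j\<in>{a, c}. \<Sum>k\<in>{a, c}. \<Sum>l\<in>{a, c}.
        w i * cnj (w j) * w k * cnj (w l))) \<partial>\<rho>)"
    using assms(3) by (intro Bochner_Integration.integral_cong) (simp_all add: algebra_simps)
  also have "\<dots> = 1 / 4 * (\<Sum>i\<in>{a, c}. \<Sum>j\<in>{a, c}. \<Sum>k\<in>{a, c}. \<Sum>l\<in>{a, c}. moment i j k l)"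
    unfolding h4 integral_mult_right_zero using assms
    by (intro arg_cong2[where f = times] refl has_bochner_integral_integral_eq
          has_bochner_integral_sum has_moment) auto
  also have "\<dots> = 1 / 4 * (moment a a a a + moment c c c c + 
      moment a a c c + moment c c a a + moment a c c a + moment c a a c + moment a c a c + moment c a c a)"
    using assms(3) by (simp add: z algebra_simps)
  finally have *: "4 * moment a a a a = moment a a a a + moment c c c c + moment a a c c + moment c c a a +
      moment a c c a + moment c a a c + moment a c a c + moment c a c a" by simp
  \<comment> \<open>Of the eight surviving moments, two equal \<open>moment a a a a\<close>, four
    equal \<open>moment a a c c\<close> and two equal \<open>moment a c a c\<close>.\<close>
  have "moment c c c c = moment a a a a" "moment c c a a = moment a a c c" "moment c a c a = moment a c a c"
    using assms moment_swap[of a c c c c c] moment_swap[of a c c c a a] moment_swap[of a c c a c a] by auto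
  moreover have "moment a c c a = moment a a c c" "moment c a a c = moment a a c c"
    using moment_commute by metis+
  ultimately have "2 * moment a a a a = 2 * (2 * moment a a c c + moment a c a c)"
    using * by (simp add: algebra_simps)
  then show ?thesis by (simp only: mult_cancel_left) simp
qed

text \<open>Transpositions of coordinates connect any two ordered pairs of distinct indices.\<close>

lemma moment_off_diagonal_unique:
  assumes "a \<in> A" "c \<in> A" "a \<noteq> c" "a' \<in> A" "c' \<in> A" "a' \<noteq> c'"
  shows "moment a a c c = moment a' a' c' c'" "moment a c a c = moment a' c' a' c'"
proof -
  \<comment> \<open>Replacing the first index and exchanging the two indices suffice: together they
    also replace the second index.\<close>
  have unique: "F a c = F a' c'"
    if sym: "\<And>a c. a \<in> A \<Longrightarrow> c \<in> A \<Longrightarrow> a \<noteq> c \<Longrightarrow> F a c = F c a"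
      and move: "\<And>a a' c. a \<in> A \<Longrightarrow> a' \<in> A \<Longrightarrow> c \<in> A \<Longrightarrow> a \<noteq> a' \<Longrightarrow> a \<noteq> c \<Longrightarrow> a' \<noteq> c \<Longrightarrow> F a c = F a' c"
    for F :: "'a \<Rightarrow> 'a \<Rightarrow> complex"
    using assms sym move by metis
  show "moment a a c c = moment a' a' c' c'"
  proof (rule unique)
    fix a c assume "a \<in> A" "c \<in> A" "a \<noteq> c"
    then show "moment a a c c = moment c c a a" using moment_swap[of a c a a c c] by simp
  next
    fix a b c assume "a \<in> A" "b \<in> A" "c \<in> A" "a \<noteq> b" "a \<noteq> c" "b \<noteq> c"
    then show "moment a a c c = moment b b c c" using moment_swap[of a b a a c c] by simp
  qed
  show "moment a c a c = moment a' c' a' c'"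
  proof (rule unique)
    fix a c assume "a \<in> A" "c \<in> A" "a \<noteq> c"
    then show "moment a c a c = moment c a c a" using moment_swap[of a c a c a c] by simp
  next
    fix a b c assume "a \<in> A" "b \<in> A" "c \<in> A" "a \<noteq> b" "a \<noteq> c" "b \<noteq> c"
    then show "moment a c a c = moment b c b c" using moment_swap[of a b a c a c] by simp
  qed
qed

text \<open>Sign flips leave only index patterns that split into equal pairs. Swaps reduce these to
  the two off-diagonal constants, and the 45 degree relation gives the diagonal value 2\<alpha> +
  \<gamma>, which is exactly what the three overlapping deltas add up to.\<close>

lemma moment_pairings:
  obtains \<alpha> \<gamma> where "\<And>a b c e. a \<in> A \<Longrightarrow> b \<in> A \<Longrightarrow> c \<in> A \<Longrightarrow> e \<in> A \<Longrightarrow>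
    moment a b c e = \<alpha> * (of_bool (a = b \<and> c = e) + of_bool (a = e \<and> b = c)) + \<gamma> * of_bool (a = c \<and> b = e)"
proof -
  obtain i where i: "i \<in> A" using cardA by (metis card.empty ex_in_conv not_numeral_le_zero)
  obtain k where k: "k \<in> A" "k \<noteq> i" using other_element i by blast
  define \<alpha> where "\<alpha> = moment i i k k"
  define \<gamma> where "\<gamma> = moment i k i k"
  have al: "moment a a c c = \<alpha>" and ga: "moment a c a c = \<gamma>" if "a \<in> A" "c \<in> A" "a \<noteq> c" for a c
    unfolding \<alpha>_def \<gamma>_def using moment_off_diagonal_unique that i k by metis+
  have al': "moment a c c a = \<alpha>" if "a \<in> A" "c \<in> A" "a \<noteq> c" for a c
    using al[OF that] moment_commute(2)[of a a c c] by simp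
  have diag: "moment a a a a = 2 * \<alpha> + \<gamma>" if "a \<in> A" for a
    using moment_diagonal al ga other_element that by metis
  show ?thesis
  proof (rule that)
    fix a b c e assume A: "a \<in> A" "b \<in> A" "c \<in> A" "e \<in> A"
    \<comment> \<open>In the third, fifth, seventh and eighth case some index occurs an odd number
      of times, and both sides are zero.\<close>
    consider "a = b" "c = e" "a = c" | "a = b" "c = e" "a \<noteq> c" | "a = b" "c \<noteq> e"
      | "a \<noteq> b" "a = c" "b = e" | "a \<noteq> b" "a = c" "b \<noteq> e" | "a \<noteq> b" "a \<noteq> c" "a = e" "b = c"
      | "a \<noteq> b" "a \<noteq> c" "a = e" "b \<noteq> c" | "a \<noteq> b" "a \<noteq> c" "a \<noteq> e" by blast
    then show "moment a b c e = \<alpha> * (of_bool (a = b \<and> c = e) + of_bool (a = e \<and> b = c)) + \<gamma> * of_bool (a = c \<and> b = e)"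
    proof cases
      case 1 then show ?thesis using diag A by simp
    next
      case 2 then show ?thesis using al A by auto
    next
      case 3 then show ?thesis using moment_sign[OF A(3) A] by (cases "a = c") auto
    next
      case 4 then show ?thesis using ga A by simp
    next
      case 5 then show ?thesis using moment_sign[OF A(2) A] by (cases "a = e") auto
    next
      case 6 then show ?thesis using al' A by simp
    next
      case 7 then show ?thesis using moment_sign[OF A(2) A] by auto
    next
      case 8 then show ?thesis using moment_sign[OF A(1) A] by auto
    qed
  qed
qed

text \<open>The mean squared overlap of \<open>w\<close> with its complex conjugate. Real orthogonal
  matrices preserve the integrand, general unitaries do not; it is the one parameter of the fourth
  moments that normalisation leaves open.\<close>

definition conj_overlap :: real where
  "conj_overlap = (\<integral>w. (cmod (\<Sum>a\<in>A. (w a)\<^sup>2))\<^sup>2 \<partial>\<rho>)"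

text \<open>The contracted integrand is the square of the squared norm, which is 1 almost
  everywhere.\<close>

lemma sum_moment_norm: "(\<Sum>a\<in>A. \<Sum>c\<in>A. moment a a c c) = 1"
proof -
  have "(\<Sum>a\<in>A. \<Sum>c\<in>A. w a * cnj (w a) * w c * cnj (w c)) = 1" if "unit_vec A w" for w
  proof -
    have "(\<Sum>a\<in>A. \<Sum>c\<in>A. w a * cnj (w a) * w c * cnj (w c)) = (\<Sum>a\<in>A. w a * cnj (w a)) * (\<Sum>c\<in>A. w c * cnj (w c))"
      by (simp add: sum_product mult.assoc)
    also have "(\<Sum>a\<in>A. w a * cnj (w a)) = of_real (\<Sum>j\<in>A. (cmod (w j))\<^sup>2)"
      by (simp only: complex_norm_square of_real_sum)
    finally show ?thesis unfolding that[unfolded unit_vec_def] by simp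
  qed
  then have "AE w in \<rho>. (\<Sum>a\<in>A. \<Sum>c\<in>A. w a * cnj (w a) * w c * cnj (w c)) = 1"
    using AE_unit by auto
  moreover have hs: "has_bochner_integral \<rho> (\<lambda>w. \<Sum>a\<in>A. \<Sum>c\<in>A. w a * cnj (w a) * w c * cnj (w c))
      (\<Sum>a\<in>A. \<Sum>c\<in>A. moment a a c c)"
    by (intro has_bochner_integral_sum has_moment)
  ultimately have "(\<integral>w. (\<Sum>a\<in>A. \<Sum>c\<in>A. w a * cnj (w a) * w c * cnj (w c)) \<partial>\<rho>) = (\<integral>w. 1 \<partial>\<rho>)"
    using borel_measurable_has_bochner_integral[OF hs] by (intro integral_cong_AE) auto
  then show ?thesis using has_bochner_integral_integral_eq[OF hs] by (simp add: prob_space)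
qed

lemma has_integral_conj_overlap:
  "has_bochner_integral \<rho> (\<lambda>w. complex_of_real ((cmod (\<Sum>a\<in>A. (w a)\<^sup>2))\<^sup>2)) (\<Sum>a\<in>A. \<Sum>c\<in>A. moment a c a c)"
proof -
  have "has_bochner_integral \<rho> (\<lambda>w. \<Sum>a\<in>A. \<Sum>c\<in>A. w a * cnj (w c) * w a * cnj (w c))
      (\<Sum>a\<in>A. \<Sum>c\<in>A. moment a c a c)"
    by (intro has_bochner_integral_sum has_moment)
  moreover have "(\<Sum>a\<in>A. \<Sum>c\<in>A. w a * cnj (w c) * w a * cnj (w c)) = of_real ((cmod (\<Sum>a\<in>A. (w a)\<^sup>2))\<^sup>2)" for w
    unfolding complex_norm_square
    by (simp add: sum_product power2_eq_square mult_ac)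
  ultimately show ?thesis by (simp only:)
qed

lemma integrable_conj_overlap: "integrable \<rho> (\<lambda>w. (cmod (\<Sum>a\<in>A. (w a)\<^sup>2))\<^sup>2)"
  using integrable_Re[OF integrable.intros[OF has_integral_conj_overlap]] by (simp only: Re_complex_of_real)

lemma sum_moment_conj: "(\<Sum>a\<in>A. \<Sum>c\<in>A. moment a c a c) = of_real conj_overlap"
  using has_bochner_integral_integral_eq[OF has_integral_conj_overlap] unfolding conj_overlap_def
  by (simp only: integral_complex_of_real)

text \<open>The two contractions of the pairing form of the moments give a linear system for its
  coefficients.\<close>
theorem moment_formula:
  assumes "a \<in> A" "b \<in> A" "c \<in> A" "e \<in> A"
  defines "N \<equiv> real (card A)"
  shows "moment a b c e = of_real
    (((N - conj_overlap) * (of_bool (a = b \<and> c = e) + of_bool (a = e \<and> b = c)) +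
      ((N + 1) * conj_overlap - 2) * of_bool (a = c \<and> b = e)) / (N * (N - 1) * (N + 2)))"
proof -
  obtain \<alpha> \<gamma> where m: "\<And>a b c e. a \<in> A \<Longrightarrow> b \<in> A \<Longrightarrow> c \<in> A \<Longrightarrow> e \<in> A \<Longrightarrow>
    moment a b c e = \<alpha> * (of_bool (a = b \<and> c = e) + of_bool (a = e \<and> b = c)) + \<gamma> * of_bool (a = c \<and> b = e)"
    using moment_pairings by blast
  let ?N = "of_nat (card A) :: complex" and ?s = "complex_of_real conj_overlap"
  have delta: "(\<Sum>a\<in>A. \<Sum>c\<in>A. of_bool (a = c)) = ?N"
    using finA by (simp add: of_bool_def)
  have "(\<Sum>a\<in>A. \<Sum>c\<in>A. moment a a c c) = (\<Sum>a\<in>A. \<Sum>c\<in>A. \<alpha> * (1 + of_bool (a = c)) + \<gamma> * of_bool (a = c))"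
    by (intro sum.cong refl) (auto simp: m)
  also have "\<dots> = \<alpha> * (?N * ?N + ?N) + \<gamma> * ?N"
    unfolding sum.distrib sum_distrib_left[symmetric] delta by simp
  finally have 1: "\<alpha> * (?N * ?N + ?N) + \<gamma> * ?N = 1"
    unfolding sum_moment_norm ..
  have "?s = (\<Sum>a\<in>A. \<Sum>c\<in>A. 2 * \<alpha> * of_bool (a = c) + \<gamma>)"
    unfolding sum_moment_conj[symmetric] by (intro sum.cong refl) (auto simp: m)
  also have "\<dots> = 2 * \<alpha> * ?N + \<gamma> * (?N * ?N)"
    unfolding sum.distrib sum_distrib_left[symmetric] delta by simp
  finally have 2: "2 * \<alpha> * ?N + \<gamma> * (?N * ?N) = ?s" ..
  have "real (card A) \<ge> 2" using cardA by simp
  then have "N * (N - 1) * (N + 2) \<noteq> 0" by (simp add: N_def)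
  then have "complex_of_real (N * (N - 1) * (N + 2)) \<noteq> 0" by (simp only: of_real_eq_0_iff not_False_eq_True)
  then have nz: "?N * (?N - 1) * (?N + 2) \<noteq> 0" by (simp add: N_def)
  \<comment> \<open>N times the first equation minus the second eliminates \<gamma>; N + 1 times the
    second minus twice the first eliminates \<alpha>. Both leave the factor N^3 + N^2 - 2N = N (N -
    1) (N + 2).\<close>
  have al: "\<alpha> * (?N * (?N - 1) * (?N + 2)) = ?N - ?s"
    using 1 2 by algebra
  have ga: "\<gamma> * (?N * (?N - 1) * (?N + 2)) = (?N + 1) * ?s - 2"
    using 1 2 by algebra
  define Q where "Q = ?N * (?N - 1) * (?N + 2)"
  define \<delta> where "\<delta> = of_bool (a = b \<and> c = e) + (of_bool (a = e \<and> b = c) :: real)"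
  define \<delta>' where "\<delta>' = (of_bool (a = c \<and> b = e) :: real)"
  have Q: "complex_of_real (N * (N - 1) * (N + 2)) = Q" by (simp add: Q_def N_def)
  have "moment a b c e = \<alpha> * of_real \<delta> + \<gamma> * of_real \<delta>'"
    unfolding m[OF assms(1-4)] \<delta>_def \<delta>'_def
    by (simp only: of_bool_def of_real_add if_distrib[of complex_of_real] of_real_0 of_real_1)
  then have "moment a b c e * Q = \<alpha> * Q * of_real \<delta> + \<gamma> * Q * of_real \<delta>'"
    by (simp add: algebra_simps)
  also have "\<dots> = of_real ((N - conj_overlap) * \<delta> + ((N + 1) * conj_overlap - 2) * \<delta>')"
    using al ga by (simp add: Q_def[symmetric] N_def)
  finally show ?thesis
    using nz unfolding of_real_divide Q \<delta>_def[symmetric] \<delta>'_def[symmetric]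
    by (simp add: Q_def[symmetric] eq_divide_eq del: of_real_add of_real_mult)
qed

end

section \<open>The overlap of a unitarily invariant vector\<close>

locale unitary_law = orthogonal_law +
  assumes law_unitary_invariant: "unitary_mat A u \<Longrightarrow> distr \<rho> (vec_space A) (mat_vec A u) = \<rho>"
begin

lemma conj_overlap_unitary: "conj_overlap = 2 / (real (card A) + 1)"
proof -
  obtain i where i: "i \<in> A" using cardA by (metis card.empty ex_in_conv not_numeral_le_zero)
  obtain k where k: "k \<in> A" "k \<noteq> i" using other_element i by blast
  \<comment> \<open>For y = 0 coordinate \<open>i\<close> is multiplied by \<open>x\<close> and
    coordinate \<open>k\<close> by \<open>- cnj x\<close>, so the monomial of
    \<open>moment i k i k\<close> picks up x^4. An eighth root of unity makes this -1, hence
    \<gamma> = 0 in the moment formula.\<close>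
  define x where "x = cis (pi / 4)"
  have "x * x = \<i>" by (simp add: x_def cis_mult)
  then have x4: "x * x * x * x = - 1" by (simp add: mult.assoc)
  have "moment i k i k = (\<integral>w. (x * x * x * x) * (w i * cnj (w k) * w i * cnj (w k)) \<partial>\<rho>)"
    by (subst moment_plane[OF law_unitary_invariant[OF unitary_plane_mat[OF finA]], of i k x 0])
       (use i k in \<open>auto simp: x_def mult_ac intro!: Bochner_Integration.integral_cong\<close>)
  then have "moment i k i k = 0" unfolding x4 by (simp add: moment_def)
  moreover have "real (card A) \<ge> 2" using cardA by simp
  ultimately have "(real (card A) + 1) * conj_overlap - 2 = 0"
    using k i by (simp add: moment_formula del: of_real_mult of_real_divide of_real_add of_real_diff)
  then show ?thesis by (simp add: field_simps)
qed

end

section \<open>Expected purity\<close>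

lemma finite_idx: "finite S \<Longrightarrow> finite (idx d S)"
  by (simp add: idx_def finite_PiE)

lemma card_idx: "finite S \<Longrightarrow> real (card (idx d S)) = dprod d S"
  by (simp add: idx_def dprod_def card_PiE)

lemma merge_idx_in:
  assumes "p \<subseteq> S" "x \<in> idx d p" "y \<in> idx d (S - p)"
  shows "merge_idx p x y \<in> idx d S"
  using assms by (fastforce simp: merge_idx_def idx_def PiE_iff extensional_def)

text \<open>This splits Kronecker deltas between merged tuples into deltas on \<open>p\<close> and
  on its complement.\<close>

lemma merge_idx_eq_iff:
  assumes "x \<in> idx d p" "x' \<in> idx d p" "y \<in> idx d (S - p)" "y' \<in> idx d (S - p)"
  shows "merge_idx p x y = merge_idx p x' y' \<longleftrightarrow> x = x' \<and> y = y'"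
proof
  assume eq: "merge_idx p x y = merge_idx p x' y'"
  have "x = x'"
  proof (rule PiE_ext[OF assms(1,2)[unfolded idx_def]])
    fix i assume "i \<in> p"
    then show "x i = x' i" using fun_cong[OF eq, of i] by (simp add: merge_idx_def)
  qed
  moreover have "y = y'"
  proof (rule PiE_ext[OF assms(3,4)[unfolded idx_def]])
    fix i assume "i \<in> S - p"
    then show "y i = y' i" using fun_cong[OF eq, of i] by (simp add: merge_idx_def)
  qed
  ultimately show "x = x' \<and> y = y'" ..
qed auto

text \<open>The three pairings of the fourth moment contribute \<open>D * d\<^sub>p\<close>, \<open>D * d\<^sub>q\<close> and \<open>D\<close>
  to the expected purity.\<close>
lemma sum_pairings:
  fixes P Q :: "'b set"
  assumes "finite P" "finite Q"
  shows "(\<Sum>y\<in>Q. \<Sum>y'\<in>Q. \<Sum>x\<in>P. \<Sum>x'\<in>P.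
      \<alpha> * (of_bool (y = y') + of_bool (x = x')) + \<gamma> * of_bool (x = x' \<and> y = y')) =
    real (card P) * real (card Q) * (\<alpha> * (real (card P) + real (card Q)) + \<gamma>)"
proof -
  have 1: "(\<Sum>y\<in>S. \<Sum>y'\<in>S. (of_bool (y = y') :: real)) = card S" if "finite S" for S :: "'b set"
    using that by (simp add: of_bool_def)
  have "(\<Sum>y\<in>Q. \<Sum>y'\<in>Q. \<Sum>x\<in>P. \<Sum>x'\<in>P.
      \<alpha> * (of_bool (y = y') + of_bool (x = x')) + \<gamma> * of_bool (x = x' \<and> y = y')) =
    (\<Sum>y\<in>Q. \<Sum>y'\<in>Q. \<alpha> * (real (card P) * real (card P) * of_bool (y = y') + real (card P))
       + \<gamma> * real (card P) * of_bool (y = y'))"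
  proof (intro sum.cong refl)
    fix y y' :: 'b
    have "(\<Sum>x\<in>P. \<Sum>x'\<in>P. \<alpha> * (of_bool (y = y') + of_bool (x = x')) + \<gamma> * of_bool (x = x' \<and> y = y')) =
      (\<Sum>x\<in>P. \<Sum>x'\<in>P. \<alpha> * of_bool (y = y')) + (\<alpha> + \<gamma> * of_bool (y = y')) * (\<Sum>x\<in>P. \<Sum>x'\<in>P. of_bool (x = x'))"
      by (simp only: sum_distrib_left sum.distrib[symmetric] of_bool_conj) (simp add: algebra_simps)
    then show "(\<Sum>x\<in>P. \<Sum>x'\<in>P. \<alpha> * (of_bool (y = y') + of_bool (x = x')) + \<gamma> * of_bool (x = x' \<and> y = y')) =
       \<alpha> * (real (card P) * real (card P) * of_bool (y = y') + real (card P))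
       + \<gamma> * real (card P) * of_bool (y = y')"
      unfolding 1[OF assms(1)] by (simp add: algebra_simps)
  qed
  also have "\<dots> = (\<Sum>y\<in>Q. \<Sum>y'\<in>Q. \<alpha> * real (card P)) + (\<alpha> * real (card P) * real (card P) + \<gamma> * real (card P)) *
     (\<Sum>y\<in>Q. \<Sum>y'\<in>Q. of_bool (y = y'))"
    by (simp only: sum_distrib_left sum.distrib[symmetric]) (simp add: algebra_simps)
  also have "\<dots> = real (card P) * real (card Q) * (\<alpha> * (real (card P) + real (card Q)) + \<gamma>)"
    unfolding 1[OF assms(2)] by (simp add: algebra_simps)
  finally show ?thesis .
qed

locale orthogonal_tensor_law = orthogonal_law "idx d {..<n}" \<rho>
  for d :: "nat \<Rightarrow> nat" and n :: nat and \<rho>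
begin

text \<open>The purity is a sum of fourth-order monomials at the merged indices (x, y), (x, y'),
  (x', y'), (x', y). The three pairings then read y = y', x = x', and both at once, which is the sum
  evaluated in \<open>sum_pairings\<close>.\<close>

lemma has_integral_purity:
  assumes "p \<subseteq> {..<n}"
  defines "D \<equiv> dprod d {..<n}" and "C \<equiv> dprod d p + dprod d ({..<n} - p)"
  shows "has_bochner_integral \<rho> (purity d n p)
    (((D - conj_overlap) * C + ((D + 1) * conj_overlap - 2)) / ((D - 1) * (D + 2)))"
proof -
  let ?P = "idx d p" and ?Q = "idx d ({..<n} - p)" and ?m = "merge_idx p"
  define K where "K = D * (D - 1) * (D + 2)"
  have finp: "finite p" using assms(1) finite_subset by blast
  have fin: "finite ?P" "finite ?Q" using finp by (simp_all add: finite_idx)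
  have D: "dprod d p * dprod d ({..<n} - p) = D"
    unfolding D_def dprod_def using assms(1) by (metis finite_lessThan mult.commute prod.subset_diff)
  have cD: "real (card (idx d {..<n})) = D" unfolding D_def by (rule card_idx) simp
  then have D0: "D \<noteq> 0" using cardA by auto
  define s where "s = conj_overlap"
  have pur: "purity d n p w = Re (\<Sum>y\<in>?Q. \<Sum>y'\<in>?Q. \<Sum>x\<in>?P. \<Sum>x'\<in>?P.
      w (?m x y) * cnj (w (?m x y')) * w (?m x' y') * cnj (w (?m x' y)))" for w
    unfolding purity_def reduced_density_def by (simp add: sum_product mult.assoc)
  have mem: "?m x y \<in> idx d {..<n}" if "x \<in> ?P" "y \<in> ?Q" for x y
    using merge_idx_in[OF assms(1) that] .
  have "has_bochner_integral \<rho> (purity d n p) (Re (\<Sum>y\<in>?Q. \<Sum>y'\<in>?Q. \<Sum>x\<in>?P. \<Sum>x'\<in>?P.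
      moment (?m x y) (?m x y') (?m x' y') (?m x' y)))"
    unfolding pur
    by (intro has_bochner_integral_bounded_linear[OF bounded_linear_Re] has_bochner_integral_sum has_moment mem)
  also have "Re (\<Sum>y\<in>?Q. \<Sum>y'\<in>?Q. \<Sum>x\<in>?P. \<Sum>x'\<in>?P. moment (?m x y) (?m x y') (?m x' y') (?m x' y)) =
    (\<Sum>y\<in>?Q. \<Sum>y'\<in>?Q. \<Sum>x\<in>?P. \<Sum>x'\<in>?P. (D - s) / K * (of_bool (y = y') + of_bool (x = x')) +
       ((D + 1) * s - 2) / K * of_bool (x = x' \<and> y = y'))"
    unfolding Re_sum
  proof (intro sum.cong refl)
    fix y y' x x' assume A: "y \<in> ?Q" "y' \<in> ?Q" "x \<in> ?P" "x' \<in> ?P"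
    have "Re (moment (?m x y) (?m x y') (?m x' y') (?m x' y)) =
      ((D - s) * (of_bool (y = y') + of_bool (x = x')) + ((D + 1) * s - 2) * of_bool (x = x' \<and> y = y')) / K"
      unfolding moment_formula[OF mem[OF A(3,1)] mem[OF A(3,2)] mem[OF A(4,2)] mem[OF A(4,1)]]
        Re_complex_of_real cD K_def s_def
      using A by (simp only: merge_idx_eq_iff) (auto simp: of_bool_def)
    then show "Re (moment (?m x y) (?m x y') (?m x' y') (?m x' y)) =
      (D - s) / K * (of_bool (y = y') + of_bool (x = x')) + ((D + 1) * s - 2) / K * of_bool (x = x' \<and> y = y')"
      by (simp only: add_divide_distrib times_divide_eq_left)
  qed
  also have "\<dots> = D * ((D - s) / K * C + ((D + 1) * s - 2) / K)"
    unfolding sum_pairings[OF fin] card_idx[OF finp] card_idx[OF finite_Diff[OF finite_lessThan]] D C_def ..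
  \<comment> \<open>The number D = \<open>dprod d p * dprod d ({..<n} - p)\<close> of basis tuples
    cancels the factor D of \<open>K\<close>.\<close>
  also have "\<dots> = ((D - s) * C + ((D + 1) * s - 2)) / ((D - 1) * (D + 2))"
    using D0 unfolding K_def by (simp add: add_divide_distrib[symmetric])
  finally show ?thesis unfolding s_def .
qed

end

section \<open>Output of a random gate\<close>

lemma mat_vec_measurable_pair [measurable]:
  "(\<lambda>(u, v). mat_vec A u v) \<in> measurable (mat_space A \<Otimes>\<^sub>M vec_space A) (vec_space A)"
proof -
  have eq: "(\<lambda>(u, v). mat_vec A u v) = (\<lambda>x. \<lambda>j\<in>A. \<Sum>k\<in>A. fst x (j, k) * snd x k)"
    by (simp add: mat_vec_def restrict_def fun_eq_iff split_beta)
  have fst_meas: "(\<lambda>x. fst x (j, k)) \<in> borel_measurable (mat_space A \<Otimes>\<^sub>M vec_space A)"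
    if "j \<in> A" "k \<in> A" for j k
    using that unfolding mat_space_def
    by (intro measurable_compose[OF measurable_fst] measurable_component_singleton) auto
  have "(\<lambda>x. snd x k) \<in> borel_measurable (mat_space A \<Otimes>\<^sub>M vec_space A)" if "k \<in> A" for k
    using that unfolding vec_space_def
    by (intro measurable_compose[OF measurable_snd] measurable_component_singleton) auto
  then have "(\<lambda>x. \<lambda>j\<in>A. \<Sum>k\<in>A. fst x (j, k) * snd x k)
      \<in> measurable (mat_space A \<Otimes>\<^sub>M vec_space A) (PiM A (\<lambda>_. borel))"
    using fst_meas by (auto intro!: measurable_restrict borel_measurable_sum borel_measurable_times)
  then show ?thesis unfolding eq vec_space_def .
qed

lemma mat_mult_measurable [measurable]: "mat_mult A v \<in> measurable (mat_space A) (mat_space A)"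
proof -
  have "mat_mult A v = (\<lambda>u. \<lambda>p\<in>A \<times> A. \<Sum>l\<in>A. v (fst p, l) * u (l, snd p))"
    by (auto simp: mat_mult_def restrict_def fun_eq_iff)
  then show ?thesis
    unfolding mat_space_def
    by (auto intro!: measurable_restrict borel_measurable_sum borel_measurable_times)
qed

lemma mat_vec_mat_mult: "mat_vec A v (mat_vec A u w) = mat_vec A (mat_mult A v u) w"
proof
  fix j
  have "(\<Sum>k\<in>A. v (j, k) * (\<Sum>l\<in>A. u (k, l) * w l)) = (\<Sum>l\<in>A. (\<Sum>k\<in>A. v (j, k) * u (k, l)) * w l)"
    unfolding sum_distrib_left sum_distrib_right by (subst sum.swap) (simp add: mult.assoc)
  then show "mat_vec A v (mat_vec A u w) j = mat_vec A (mat_mult A v u) w j"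
    by (simp add: mat_vec_def mat_mult_def)
qed

text \<open>The common core of two conservation laws: with \<open>f\<close> the conjugate of
  \<open>g\<close> it gives preservation of the norm, with \<open>f = g\<close> real orthogonal it
  gives preservation of the sum of squares.\<close>

lemma sum_biorthogonal:
  fixes f g :: "'a \<times> 'a \<Rightarrow> complex"
  assumes "finite A"
    and "\<And>k l. k \<in> A \<Longrightarrow> l \<in> A \<Longrightarrow> (\<Sum>j\<in>A. f (j, k) * g (j, l)) = (if k = l then 1 else 0)"
  shows "(\<Sum>j\<in>A. (\<Sum>k\<in>A. f (j, k) * v k) * (\<Sum>l\<in>A. g (j, l) * w l)) = (\<Sum>k\<in>A. v k * w k)"
proof -
  have "(\<Sum>j\<in>A. (\<Sum>k\<in>A. f (j, k) * v k) * (\<Sum>l\<in>A. g (j, l) * w l)) =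
      (\<Sum>j\<in>A. \<Sum>k\<in>A. \<Sum>l\<in>A. f (j, k) * v k * (g (j, l) * w l))"
    by (simp only: sum_product)
  also have "\<dots> = (\<Sum>k\<in>A. \<Sum>j\<in>A. \<Sum>l\<in>A. f (j, k) * v k * (g (j, l) * w l))"
    by (rule sum.swap)
  also have "\<dots> = (\<Sum>k\<in>A. \<Sum>l\<in>A. \<Sum>j\<in>A. f (j, k) * v k * (g (j, l) * w l))"
    by (intro sum.cong refl sum.swap)
  also have "\<dots> = (\<Sum>k\<in>A. \<Sum>l\<in>A. v k * w l * (\<Sum>j\<in>A. f (j, k) * g (j, l)))"
    by (simp only: sum_distrib_left mult_ac)
  also have "\<dots> = (\<Sum>k\<in>A. \<Sum>l\<in>A. if k = l then v k * w l else 0)"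
    by (intro sum.cong refl) (simp add: assms(2))
  also have "\<dots> = (\<Sum>k\<in>A. v k * w k)" using assms(1) by simp
  finally show ?thesis .
qed

lemma unit_vec_mat_vec:
  assumes "finite A" "unitary_mat A u" "unit_vec A v"
  shows "unit_vec A (mat_vec A u v)"
proof -
  have "complex_of_real (\<Sum>j\<in>A. (cmod (mat_vec A u v j))\<^sup>2) =
      (\<Sum>j\<in>A. (\<Sum>k\<in>A. cnj (u (j, k)) * cnj (v k)) * (\<Sum>l\<in>A. u (j, l) * v l))"
    unfolding of_real_sum complex_norm_square
    by (intro sum.cong refl) (simp add: mat_vec_def mult.commute)
  also have "\<dots> = (\<Sum>k\<in>A. cnj (v k) * v k)"
    using assms(2) by (intro sum_biorthogonal[of A "\<lambda>p. cnj (u p)" u] assms(1)) (auto simp: unitary_mat_def)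
  also have "\<dots> = complex_of_real (\<Sum>j\<in>A. (cmod (v j))\<^sup>2)"
    unfolding of_real_sum complex_norm_square by (simp add: mult.commute)
  finally show ?thesis using assms(3) by (simp only: of_real_eq_iff unit_vec_def)
qed

text \<open>For real entries conjugation is trivial, so unitarity says that the columns are
  orthonormal for the bilinear form as well.\<close>

lemma sum_square_mat_vec:
  assumes "finite A" "orthogonal_mat A u"
  shows "(\<Sum>j\<in>A. (mat_vec A u v j)\<^sup>2) = (\<Sum>j\<in>A. (v j)\<^sup>2)"
proof -
  have "(\<Sum>j\<in>A. u (j, k) * u (j, l)) = (if k = l then 1 else 0)" if "k \<in> A" "l \<in> A" for k l
  proof -
    have "(\<Sum>j\<in>A. u (j, k) * u (j, l)) = (\<Sum>j\<in>A. cnj (u (j, k)) * u (j, l))"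
      using assms(2) that by (intro sum.cong refl) (auto simp: orthogonal_mat_def Reals_cnj_iff)
    then show ?thesis using assms(2) that by (auto simp: orthogonal_mat_def unitary_mat_def)
  qed
  from sum_biorthogonal[OF assms(1) this, of v v] show ?thesis
    by (simp add: mat_vec_def power2_eq_square)
qed

lemma unit_vec_measurable [measurable]: "Measurable.pred (vec_space A) (unit_vec A)"
proof -
  have [measurable]: "(\<lambda>w. w a) \<in> borel_measurable (vec_space A)" if "a \<in> A" for a
    using that unfolding vec_space_def by (rule measurable_component_singleton)
  have "(\<lambda>w. \<Sum>j\<in>A. (cmod (w j))\<^sup>2) \<in> borel_measurable (vec_space A)"
    by (intro borel_measurable_sum) simp
  then show ?thesis unfolding unit_vec_def by simp
qed

text \<open>Almost sure unitarity with invariance under left multiplication by orthogonal matrices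
  holds for both Haar measures, so both gate groups share what follows. Gate and input are
  independent.\<close>

locale random_gate = pair_prob_space \<mu> \<sigma>
  for A :: "'a set" and \<mu> :: "('a \<times> 'a \<Rightarrow> complex) measure" and \<sigma> :: "('a \<Rightarrow> complex) measure" +
  assumes finA: "finite A" and cardA: "card A \<ge> 2"
    and sets_gate [measurable_cong]: "sets \<mu> = sets (mat_space A)"
    and sets_input [measurable_cong]: "sets \<sigma> = sets (vec_space A)"
    and AE_unitary: "AE u in \<mu>. unitary_mat A u"
    and AE_input: "AE v in \<sigma>. unit_vec A v"
    and gate_invariant: "orthogonal_mat A v \<Longrightarrow> distr \<mu> (mat_space A) (mat_mult A v) = \<mu>"
begin

definition output_law :: "('a \<Rightarrow> complex) measure" where
  "output_law = distr (\<mu> \<Otimes>\<^sub>M \<sigma>) (vec_space A) (\<lambda>(u, v). mat_vec A u v)"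

lemma apply_measurable [measurable]: "(\<lambda>(u, v). mat_vec A u v) \<in> measurable (\<mu> \<Otimes>\<^sub>M \<sigma>) (vec_space A)"
  using mat_vec_measurable_pair measurable_cong_sets[OF sets_pair_measure_cong[OF sets_gate sets_input] refl] by blast

text \<open>By associativity the extra matrix can be absorbed into the gate, whose law absorbs it.
  Stated for one matrix at a time, this yields orthogonal and unitary invariance alike.\<close>

lemma output_law_invariant:
  assumes "distr \<mu> (mat_space A) (mat_mult A u) = \<mu>"
  shows "distr output_law (vec_space A) (mat_vec A u) = output_law"
proof -
  have mm: "mat_mult A u \<in> measurable \<mu> (mat_space A)" by measurable
  \<comment> \<open>\<open>pair_measure_distr\<close> pushes both factors forward, so the input is
    pushed forward along the identity.\<close>
  have id: "(\<lambda>v. v) \<in> measurable \<sigma> (vec_space A)" by measurable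
  have dsig: "distr \<sigma> (vec_space A) (\<lambda>v. v) = \<sigma>"
    using distr_id2[OF sets_input[symmetric]] .
  have m2: "(\<lambda>(x, y). (mat_mult A u x, y)) \<in> measurable (\<mu> \<Otimes>\<^sub>M \<sigma>) (mat_space A \<Otimes>\<^sub>M vec_space A)"
    by measurable
  have "distr output_law (vec_space A) (mat_vec A u) =
      distr (\<mu> \<Otimes>\<^sub>M \<sigma>) (vec_space A) (\<lambda>(x, v). mat_vec A (mat_mult A u x) v)"
    unfolding output_law_def
    by (subst distr_distr) (auto simp: comp_def case_prod_unfold mat_vec_mat_mult)
  also have "\<dots> = distr (distr (\<mu> \<Otimes>\<^sub>M \<sigma>) (mat_space A \<Otimes>\<^sub>M vec_space A) (\<lambda>(x, y). (mat_mult A u x, y)))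
      (vec_space A) (\<lambda>(u, v). mat_vec A u v)"
    by (subst distr_distr[OF _ m2]) (auto simp: comp_def case_prod_unfold)
  also have "distr (\<mu> \<Otimes>\<^sub>M \<sigma>) (mat_space A \<Otimes>\<^sub>M vec_space A) (\<lambda>(x, y). (mat_mult A u x, y)) = \<mu> \<Otimes>\<^sub>M \<sigma>"
    using pair_measure_distr[OF mm id] M2.sigma_finite_measure_axioms unfolding dsig assms by simp
  finally show ?thesis unfolding output_law_def .
qed

lemma AE_apply_pair:
  assumes "Measurable.pred (\<mu> \<Otimes>\<^sub>M \<sigma>) P" and "AE u in \<mu>. G u"
    and "\<And>u v. G u \<Longrightarrow> unit_vec A v \<Longrightarrow> P (u, v)"
  shows "AE x in \<mu> \<Otimes>\<^sub>M \<sigma>. P x"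
proof (rule AE_pair_measure)
  show "{x \<in> space (\<mu> \<Otimes>\<^sub>M \<sigma>). P x} \<in> sets (\<mu> \<Otimes>\<^sub>M \<sigma>)" using assms(1) by simp
  show "AE u in \<mu>. AE v in \<sigma>. P (u, v)"
    using assms(2) by eventually_elim (use AE_input assms(3) in auto)
qed

sublocale out: orthogonal_law A output_law
proof (intro orthogonal_law.intro orthogonal_law_axioms.intro)
  show "prob_space output_law"
    unfolding output_law_def by (rule prob_space_distr[OF apply_measurable])
  show "finite A" "2 \<le> card A" by (fact finA cardA)+
  show "sets output_law = sets (vec_space A)" by (simp add: output_law_def)
  show "AE w in output_law. unit_vec A w"
    unfolding output_law_def
  proof (subst AE_distr_iff[OF apply_measurable])
    show "{w \<in> space (vec_space A). unit_vec A w} \<in> sets (vec_space A)" by simp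
    show "AE x in \<mu> \<Otimes>\<^sub>M \<sigma>. unit_vec A (case x of (u, v) \<Rightarrow> mat_vec A u v)"
    proof (rule AE_apply_pair[OF _ AE_unitary])
      show "Measurable.pred (\<mu> \<Otimes>\<^sub>M \<sigma>) (\<lambda>x. unit_vec A (case x of (u, v) \<Rightarrow> mat_vec A u v))"
        by (rule measurable_compose[OF apply_measurable unit_vec_measurable])
    qed (simp add: unit_vec_mat_vec[OF finA])
  qed
  show "distr output_law (vec_space A) (mat_vec A u) = output_law" if "orthogonal_mat A u" for u
    using output_law_invariant gate_invariant that by blast
qed

text \<open>Change of variables followed by Fubini; the inner integral is the average over inputs at
  a fixed gate.\<close>

lemma integral_output_law:
  fixes f :: "('a \<Rightarrow> complex) \<Rightarrow> real"
  assumes "integrable output_law f"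
  shows "(\<integral>w. f w \<partial>output_law) = (\<integral>u. \<integral>v. f (mat_vec A u v) \<partial>\<sigma> \<partial>\<mu>)"
proof -
  have f: "f \<in> borel_measurable (vec_space A)"
    using assms borel_measurable_integrable by (auto simp: output_law_def)
  have "integrable (\<mu> \<Otimes>\<^sub>M \<sigma>) (\<lambda>x. f (case x of (u, v) \<Rightarrow> mat_vec A u v))"
    using assms unfolding output_law_def by (subst (asm) integrable_distr_eq[OF apply_measurable f])
  from integral_fst'[OF this] show ?thesis
    unfolding output_law_def by (subst integral_distr[OF apply_measurable f]) simp
qed

text \<open>A real orthogonal gate preserves the bilinear form \<open>\<Sum>a. w\<^sub>a * w\<^sub>a\<close>, so the overlap can be
  computed on the input.\<close>
lemma conj_overlap_orthogonal:
  assumes "AE u in \<mu>. orthogonal_mat A u"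
  shows "out.conj_overlap = (\<integral>v. (cmod (\<Sum>a\<in>A. (v a)\<^sup>2))\<^sup>2 \<partial>\<sigma>)"
proof -
  let ?f = "\<lambda>w. (cmod (\<Sum>a\<in>A. (w a :: complex)\<^sup>2))\<^sup>2"
  have "out.conj_overlap = (\<integral>u. \<integral>v. ?f (mat_vec A u v) \<partial>\<sigma> \<partial>\<mu>)"
    unfolding out.conj_overlap_def by (rule integral_output_law[OF out.integrable_conj_overlap])
  also have "\<dots> = (\<integral>u. \<integral>v. ?f v \<partial>\<sigma> \<partial>\<mu>)"
  proof (rule integral_cong_AE)
    have f: "?f \<in> borel_measurable (vec_space A)"
      using borel_measurable_integrable[OF out.integrable_conj_overlap] by (auto simp: output_law_def)
    have "(\<lambda>x. ?f (case x of (u, v) \<Rightarrow> mat_vec A u v)) \<in> borel_measurable (\<mu> \<Otimes>\<^sub>M \<sigma>)"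
      by (rule measurable_compose[OF apply_measurable f])
    then show "(\<lambda>u. \<integral>v. ?f (mat_vec A u v) \<partial>\<sigma>) \<in> borel_measurable \<mu>"
      by (intro M2.borel_measurable_lebesgue_integral) (simp add: split_beta)
    show "AE u in \<mu>. (\<integral>v. ?f (mat_vec A u v) \<partial>\<sigma>) = (\<integral>v. ?f v \<partial>\<sigma>)"
      using assms by eventually_elim (simp add: sum_square_mat_vec[OF finA])
  qed simp
  finally show ?thesis by (simp add: M1.prob_space)
qed

end

section \<open>Product inputs and the one-tangle\<close>

text \<open>A multiplicative \<open>f\<close> turns each summand into a product over the parties,
  and a sum over tuples of such products factorises. It is applied to the squared modulus and to the
  square.\<close>

lemma sum_tensor:
  fixes f :: "complex \<Rightarrow> 'b::comm_semiring_1"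
  assumes "\<And>\<psi>. f (\<Prod>i<n. \<psi> i) = (\<Prod>i<n. f (\<psi> i))"
  shows "(\<Sum>j\<in>idx d {..<n}. f (tensor d n \<psi> j)) = (\<Prod>i<n. \<Sum>k<d i. f (\<psi> i k))"
proof -
  have "(\<Sum>j\<in>idx d {..<n}. f (tensor d n \<psi> j)) = (\<Sum>j\<in>idx d {..<n}. \<Prod>i<n. f (\<psi> i (j i)))"
    by (intro sum.cong refl) (simp add: tensor_def assms)
  then show ?thesis unfolding idx_def by (subst prod_sum_PiE) simp_all
qed

lemma unit_vec_tensor:
  assumes "\<And>i. i < n \<Longrightarrow> unit_vec {..<d i} (\<psi> i)"
  shows "unit_vec (idx d {..<n}) (tensor d n \<psi>)"
proof -
  have "(\<Sum>j\<in>idx d {..<n}. (cmod (tensor d n \<psi> j))\<^sup>2) = (\<Prod>i<n. \<Sum>k<d i. (cmod (\<psi> i k))\<^sup>2)"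
    by (rule sum_tensor) (simp add: prod_norm[symmetric] prod_power_distrib)
  then show ?thesis using assms by (simp add: unit_vec_def)
qed

lemma sum_square_tensor:
  "(cmod (\<Sum>j\<in>idx d {..<n}. (tensor d n \<psi> j)\<^sup>2))\<^sup>2 = (\<Prod>i<n. (cmod (\<Sum>k<d i. (\<psi> i k)\<^sup>2))\<^sup>2)"
proof -
  have "(\<Sum>j\<in>idx d {..<n}. (tensor d n \<psi> j)\<^sup>2) = (\<Prod>i<n. \<Sum>k<d i. (\<psi> i k)\<^sup>2)"
    by (rule sum_tensor) (simp add: prod_power_distrib)
  then show ?thesis by (simp add: prod_norm[symmetric] prod_power_distrib)
qed

text \<open>A part containing 0 is determined by its other elements, an arbitrary subset of {1..<n};
  only the choice giving the whole set is excluded.\<close>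

lemma card_bipartitions:
  assumes "n > 0"
  shows "real (card (bipartitions n)) = 2 ^ (n - 1) - 1"
proof -
  have "bipartitions n = insert 0 ` Pow {1..<n} - {{..<n}}"
  proof (intro set_eqI iffI)
    fix p assume p: "p \<in> bipartitions n"
    then have sub: "p \<subseteq> {..<n}" and z: "0 \<in> p" and ne: "p \<noteq> {..<n}" by (simp_all add: bipartitions_def)
    have "p - {0} \<in> Pow {1..<n}" using sub by fastforce
    moreover have "p = insert 0 (p - {0})" using z by blast
    ultimately show "p \<in> insert 0 ` Pow {1..<n} - {{..<n}}" using ne by (metis DiffI image_eqI singletonD)
  qed (use assms in \<open>auto simp: bipartitions_def\<close>)
  moreover have "{..<n} \<in> insert 0 ` Pow {1..<n}"
    using assms by (intro image_eqI[of _ _ "{1..<n}"]) auto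
  moreover have "card (insert 0 ` Pow {1..<n}) = 2 ^ (n - 1)"
  proof -
    have "inj_on (insert 0) (Pow {1..<n})"
    proof (rule inj_onI)
      fix x y assume "x \<in> Pow {1..<n}" "y \<in> Pow {1..<n}" and eq: "insert 0 x = insert 0 y"
      then have "0 \<notin> x" "0 \<notin> y" by auto
      then show "x = y" using eq by (metis Diff_insert_absorb)
    qed
    then show ?thesis by (simp add: card_image card_Pow)
  qed
  ultimately have "card (bipartitions n) = 2 ^ (n - 1) - 1" by (simp add: card_Diff_singleton)
  then show ?thesis by (simp add: of_nat_diff)
qed

text \<open>In the expanded product, the subset S collects the factors that contribute
  \<open>d i\<close> rather than 1.\<close>

lemma constB_eq: "constB d n = (\<Prod>i<n. real (d i) + 1)"
  unfolding constB_def dprod_def by (subst prod_add) simp_all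

section \<open>Expected one-tangle\<close>

context orthogonal_tensor_law
begin

text \<open>By linearity the terms d_p + d_q add up to \<open>constC d n\<close>, while the part of
  the purity independent of \<open>p\<close> is counted \<open>M\<close> times and so survives the
  normalisation unchanged.\<close>

lemma has_integral_one_tangle:
  assumes "n \<ge> 2"
  defines "D \<equiv> constD d n" and "M \<equiv> 2 ^ (n - 1) - 1"
  shows "has_bochner_integral \<rho> (one_tangle d n)
    (2 * (1 - ((D - conj_overlap) / M * constC d n + ((D + 1) * conj_overlap - 2)) / ((D - 1) * (D + 2))))"
proof -
  define s where "s = conj_overlap"
  define Q where "Q = (D - 1) * (D + 2)"
  define e where "e p = ((D - s) * (dprod d p + dprod d ({..<n} - p)) + ((D + 1) * s - 2)) / Q" for p
  have M: "M > 0" unfolding M_def using assms(1) by simp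
  have "has_bochner_integral \<rho> (one_tangle d n) (1 / M * (\<Sum>p\<in>bipartitions n. 2 * (1 - e p)))"
    unfolding one_tangle_def tau_def M_def[symmetric]
  proof (intro has_bochner_integral_mult_right has_bochner_integral_sum has_bochner_integral_diff)
    fix p assume "p \<in> bipartitions n"
    then have "p \<subseteq> {..<n}" by (simp add: bipartitions_def)
    from has_integral_purity[OF this] show "has_bochner_integral \<rho> (purity d n p) (e p)"
      by (simp only: e_def D_def constD_def s_def Q_def)
    show "has_bochner_integral \<rho> (\<lambda>_. 1) (1::real)"
      using has_bochner_integral_integrable[of \<rho> "\<lambda>_. 1::real"] by (simp add: prob_space)
  qed
  also have "(\<Sum>p\<in>bipartitions n. 2 * (1 - e p)) = 2 * (M - ((D - s) * constC d n + M * ((D + 1) * s - 2)) / Q)"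
    using card_bipartitions[of n] assms(1)
    by (simp add: sum_distrib_left[symmetric] sum_subtractf e_def sum_divide_distrib[symmetric]
        sum.distrib constC_def M_def)
  also have "1 / M * \<dots> = 2 * (1 - ((D - s) / M * constC d n + ((D + 1) * s - 2)) / Q)"
  proof -
    have "1 / M * (2 * (M - (a + M * b) / Q)) = 2 * (1 - (a / M + b) / Q)" for a b
      \<comment> \<open>For Q = 0 both quotients are 0 by convention, so the rearrangement is valid
        there too.\<close>
      using M by (cases "Q = 0") (simp_all add: field_simps)
    then show ?thesis by simp
  qed
  finally show ?thesis unfolding s_def Q_def .
qed

end

section \<open>Independent random product states\<close>

locale product_input =
  fixes d :: "nat \<Rightarrow> nat" and n :: nat and \<nu> :: "nat \<Rightarrow> (nat \<Rightarrow> complex) measure"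
  assumes parties: "n \<ge> 2" and dims: "i < n \<Longrightarrow> d i \<ge> 2"
    and states: "i < n \<Longrightarrow> invariant_state_measure {..<d i} (\<nu> i)"
begin

definition input_law :: "((nat \<Rightarrow> nat) \<Rightarrow> complex) measure" where
  "input_law = distr (PiM {..<n} \<nu>) (vec_space (idx d {..<n})) (tensor d n)"

lemma unitary_law_state: "i < n \<Longrightarrow> unitary_law {..<d i} (\<nu> i)"
  using states[of i] dims[of i]
  by (intro unitary_law.intro orthogonal_law.intro orthogonal_law_axioms.intro unitary_law_axioms.intro)
     (simp_all add: invariant_state_measure_def orthogonal_mat_def)

lemma prob_state: "i < n \<Longrightarrow> prob_space (\<nu> i)"
  using states by (simp add: invariant_state_measure_def)

lemma tensor_measurable: "tensor d n \<in> measurable (PiM {..<n} \<nu>) (vec_space (idx d {..<n}))"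
proof -
  have eq: "tensor d n = (\<lambda>\<psi>. \<lambda>j\<in>idx d {..<n}. \<Prod>i<n. \<psi> i (j i))"
    by (simp add: tensor_def restrict_def fun_eq_iff)
  have "(\<lambda>\<psi>. \<psi> i (j i)) \<in> borel_measurable (PiM {..<n} \<nu>)" if "i < n" "j \<in> idx d {..<n}" for i j
  proof (rule measurable_compose[OF measurable_component_singleton])
    interpret unitary_law "{..<d i}" "\<nu> i" using that(1) by (rule unitary_law_state)
    show "(\<lambda>v. v (j i)) \<in> borel_measurable (\<nu> i)"
      using that by (intro component_measurable) (auto simp: idx_def)
  qed (use that in simp)
  then show ?thesis
    unfolding eq vec_space_def by (intro measurable_restrict borel_measurable_prod) auto
qed

lemma AE_input_law: "AE v in input_law. unit_vec (idx d {..<n}) v"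
  unfolding input_law_def
proof (subst AE_distr_iff[OF tensor_measurable])
  have "AE \<psi> in PiM {..<n} \<nu>. unit_vec {..<d i} (\<psi> i)" if "i < n" for i
    using states[OF that] prob_state that
    by (intro AE_PiM_component) (auto simp: invariant_state_measure_def)
  then have "AE \<psi> in PiM {..<n} \<nu>. \<forall>i\<in>{..<n}. unit_vec {..<d i} (\<psi> i)"
    by (intro AE_finite_allI) auto
  then show "AE \<psi> in PiM {..<n} \<nu>. unit_vec (idx d {..<n}) (tensor d n \<psi>)"
    by eventually_elim (auto intro: unit_vec_tensor)
qed simp

text \<open>The overlap integrand of a tensor product is the product of those of its factors.
  Independence turns the integral into a product of one-party integrals, each given by
  \<open>conj_overlap_unitary\<close>.\<close>

lemma integral_conj_overlap_input:
  "(\<integral>v. (cmod (\<Sum>a\<in>idx d {..<n}. (v a)\<^sup>2))\<^sup>2 \<partial>input_law) = (\<Prod>i<n. 2 / (real (d i) + 1))"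
proof -
  \<comment> \<open>\<open>product_sigma_finite\<close> asks for a sigma-finite measure at every
    index, whereas \<open>\<nu> i\<close> is constrained only for i < n; \<open>\<nu> 0\<close>
    fills the other indices.\<close>
  define N where "N i = (if i < n then \<nu> i else \<nu> 0)" for i
  have "prob_space (N i)" for i using prob_state parties by (auto simp: N_def)
  then interpret product_sigma_finite N
    by (intro product_sigma_finite.intro prob_space_imp_sigma_finite)
  let ?g = "\<lambda>i v. (cmod (\<Sum>k<d i. (v k :: complex)\<^sup>2))\<^sup>2"
  have state: "integrable (N i) (?g i) \<and> integral\<^sup>L (N i) (?g i) = 2 / (real (d i) + 1)" if "i < n" for i
  proof -
    interpret S: unitary_law "{..<d i}" "\<nu> i" using that by (rule unitary_law_state)
    show ?thesis using that S.integrable_conj_overlap S.conj_overlap_unitary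
      by (simp add: N_def S.conj_overlap_def)
  qed
  have comp: "(\<lambda>v. v a) \<in> borel_measurable (vec_space (idx d {..<n}))" if "a \<in> idx d {..<n}" for a
    using that unfolding vec_space_def by (rule measurable_component_singleton)
  have "(\<lambda>v. (cmod (\<Sum>a\<in>idx d {..<n}. (v a)\<^sup>2))\<^sup>2) \<in> borel_measurable (vec_space (idx d {..<n}))"
    using borel_measurable_sum[OF borel_measurable_power[OF comp]] by measurable
  then have "(\<integral>v. (cmod (\<Sum>a\<in>idx d {..<n}. (v a)\<^sup>2))\<^sup>2 \<partial>input_law) =
      (\<integral>\<psi>. (\<Prod>i<n. ?g i (\<psi> i)) \<partial>PiM {..<n} \<nu>)"
    unfolding input_law_def by (subst integral_distr[OF tensor_measurable]) (simp_all only: sum_square_tensor)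
  also have "PiM {..<n} \<nu> = PiM {..<n} N"
    by (intro PiM_cong) (auto simp: N_def)
  also have "(\<integral>\<psi>. (\<Prod>i<n. ?g i (\<psi> i)) \<partial>PiM {..<n} N) = (\<Prod>i<n. integral\<^sup>L (N i) (?g i))"
    using state by (intro product_integral_prod) auto
  also have "\<dots> = (\<Prod>i<n. 2 / (real (d i) + 1))"
    using state by (intro prod.cong) auto
  finally show ?thesis .
qed

lemma constD_ge: "constD d n \<ge> 2"
proof -
  have "real (d 0) * 1 \<le> real (d 0) * (\<Prod>i\<in>{..<n} - {0}. real (d i))"
    using dims by (intro mult_left_mono prod_ge_1) (force intro: order_trans[of 1 2])+
  also have "\<dots> = constD d n"
    using parties unfolding constD_def dprod_def by (subst prod.remove[of _ 0]) auto
  finally show ?thesis using dims[of 0] parties by linarith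
qed

lemma random_gateI:
  assumes "prob_space \<mu>" "sets \<mu> = sets (mat_space (idx d {..<n}))"
    "AE u in \<mu>. unitary_mat (idx d {..<n}) u"
    "\<And>v. orthogonal_mat (idx d {..<n}) v \<Longrightarrow> distr \<mu> (mat_space (idx d {..<n})) (mat_mult (idx d {..<n}) v) = \<mu>"
  shows "random_gate (idx d {..<n}) \<mu> input_law"
proof -
  have P: "prob_space (PiM {..<n} \<nu>)" by (intro prob_space_PiM) (simp add: prob_state)
  have "prob_space input_law"
    unfolding input_law_def by (rule prob_space.prob_space_distr[OF P tensor_measurable])
  moreover have "card (idx d {..<n}) \<ge> 2"
    using constD_ge card_idx[of "{..<n}" d] by (simp add: constD_def)
  ultimately show ?thesis
    using assms AE_input_law
    by (intro random_gate.intro random_gate_axioms.intro pair_prob_space.intro pair_sigma_finite.intro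
          prob_space_imp_sigma_finite)
       (simp_all add: finite_idx input_law_def)
qed

text \<open>The ensemble of gates enters only through the output overlap \<open>s\<close>, so each
  average in the theorem reduces to finding \<open>s\<close>.\<close>

lemma integral_entangling_power:
  assumes "random_gate (idx d {..<n}) \<mu> input_law"
  defines "D \<equiv> constD d n" and "M \<equiv> 2 ^ (n - 1) - 1"
    and "s \<equiv> orthogonal_law.conj_overlap (idx d {..<n}) (random_gate.output_law (idx d {..<n}) \<mu> input_law)"
  shows "(\<integral>U. entangling_power d n \<nu> U \<partial>\<mu>) =
    2 * (1 - ((D - s) / M * constC d n + ((D + 1) * s - 2)) / ((D - 1) * (D + 2)))"
proof -
  interpret G: random_gate "idx d {..<n}" \<mu> input_law by fact
  interpret T: orthogonal_tensor_law d n G.output_law ..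
  have I: "has_bochner_integral G.output_law (one_tangle d n)
    (2 * (1 - ((D - s) / M * constC d n + ((D + 1) * s - 2)) / ((D - 1) * (D + 2))))"
    using T.has_integral_one_tangle[OF parties] unfolding D_def M_def s_def .
  have m: "one_tangle d n \<in> borel_measurable (vec_space (idx d {..<n}))"
    using borel_measurable_has_bochner_integral[OF I] by (simp add: G.output_law_def)
  have "entangling_power d n \<nu> U = (\<integral>v. one_tangle d n (mat_vec (idx d {..<n}) U v) \<partial>input_law)" for U
    unfolding entangling_power_def input_law_def
    by (subst integral_distr[OF tensor_measurable measurable_compose[OF mat_vec_measurable m]]) simp
  then show ?thesis
    using G.integral_output_law[OF integrable.intros[OF I]] has_bochner_integral_integral_eq[OF I] by simp
qed

end

section \<open>The averages over U(D) and O(D)\<close>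

theorem theorem6:
  fixes n :: nat and d :: "nat \<Rightarrow> nat"
    and \<nu> :: "nat \<Rightarrow> (nat \<Rightarrow> complex) measure"
    and \<mu>U \<mu>O :: "((nat \<Rightarrow> nat) \<times> (nat \<Rightarrow> nat) \<Rightarrow> complex) measure"
  assumes n: "n \<ge> 2"
    and d: "\<forall>i<n. d i \<ge> 2"
    and states: "\<forall>i<n. invariant_state_measure {..<d i} (\<nu> i)"
    and haarU: "haar_unitary (idx d {..<n}) \<mu>U"
    and haarO: "haar_orthogonal (idx d {..<n}) \<mu>O"
  shows "((\<integral>U. entangling_power d n \<nu> U \<partial>\<mu>U) =
           2 * (1 - (\<Prod>i<n. 1 / (real (d i) + 1)) *
                    (constB d n * constC d n /
                      ((2 ^ (n - 1) - 1) * (constD d n + 1))))) \<and>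
         ((\<integral>U. entangling_power d n \<nu> U \<partial>\<mu>O) =
           2 * (1 - (\<Prod>i<n. 1 / (real (d i) + 1)) *
                    ((2 ^ n * (constD d n + 1) - 2 * constB d n
                      + (constB d n * constD d n - 2 ^ n) / (2 ^ (n - 1) - 1) * constC d n) /
                     ((constD d n - 1) * (constD d n + 2)))))"
proof
  interpret product_input d n \<nu> using n d states by unfold_locales auto
  let ?A = "idx d {..<n}"
  define D where "D = constD d n"
  define B where "B = constB d n"
  define C where "C = constC d n"
  define M :: real where "M = 2 ^ (n - 1) - 1"
  have D: "D \<ge> 2" unfolding D_def by (rule constD_ge)
  have B: "B > 0" unfolding B_def constB_eq by (intro prod_pos) (simp add: add_nonneg_pos)
  have invB: "(\<Prod>i<n. 1 / (real (d i) + 1)) = 1 / B"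
    unfolding B_def constB_eq by (simp add: prod_dividef)
  have cardA: "real (card ?A) = D"
    unfolding D_def constD_def by (rule card_idx) simp

  have gU: "random_gate ?A \<mu>U input_law"
    using haarU by (intro random_gateI) (auto simp: haar_unitary_def orthogonal_mat_def)
  interpret U: random_gate ?A \<mu>U input_law by (fact gU)
  interpret UL: unitary_law ?A U.output_law
    using haarU U.output_law_invariant by unfold_locales (auto simp: haar_unitary_def)
  have "(\<integral>U. entangling_power d n \<nu> U \<partial>\<mu>U) =
      2 * (1 - ((D - 2 / (D + 1)) / M * C + ((D + 1) * (2 / (D + 1)) - 2)) / ((D - 1) * (D + 2)))"
    using integral_entangling_power[OF gU]
    unfolding UL.conj_overlap_unitary cardA D_def[symmetric] C_def[symmetric] M_def[symmetric] .
  \<comment> \<open>At s = 2 / (D + 1) the pairing term (D + 1) s - 2 vanishes, and D - s = (D - 1)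
    (D + 2) / (D + 1) cancels the denominator.\<close>
  also have "((D - 2 / (D + 1)) / M * C + ((D + 1) * (2 / (D + 1)) - 2)) / ((D - 1) * (D + 2)) = C / (M * (D + 1))"
  proof -
    have "D - 2 / (D + 1) = (D - 1) * (D + 2) / (D + 1)" using D by (simp add: field_simps)
    moreover have "(D + 1) * (2 / (D + 1)) - 2 = 0" using D by (simp add: field_simps)
    ultimately show ?thesis using D by simp
  qed
  \<comment> \<open>The factor B / B is inserted to match the stated form, where the product of the
    1 / (d_i + 1) is 1 / B.\<close>
  also have "\<dots> = 1 / B * (B * C / (M * (D + 1)))" using B by simp
  finally show "(\<integral>U. entangling_power d n \<nu> U \<partial>\<mu>U) =
      2 * (1 - (\<Prod>i<n. 1 / (real (d i) + 1)) *
        (constB d n * constC d n / ((2 ^ (n - 1) - 1) * (constD d n + 1))))"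
    unfolding invB by (simp only: D_def B_def C_def M_def)

  have gO: "random_gate ?A \<mu>O input_law"
    using haarO by (intro random_gateI) (auto simp: haar_orthogonal_def orthogonal_mat_def)
  interpret O: random_gate ?A \<mu>O input_law by (fact gO)
  have orth: "AE u in \<mu>O. orthogonal_mat ?A u" using haarO by (simp add: haar_orthogonal_def)
  \<comment> \<open>An orthogonal gate passes on the overlap of its input, the product of the 2 /
    (d_i + 1).\<close>
  have s: "O.out.conj_overlap = 2 ^ n / B"
    unfolding O.conj_overlap_orthogonal[OF orth]
      integral_conj_overlap_input B_def constB_eq by (simp add: prod_dividef)
  have "(\<integral>U. entangling_power d n \<nu> U \<partial>\<mu>O) =
      2 * (1 - ((D - 2 ^ n / B) / M * C + ((D + 1) * (2 ^ n / B) - 2)) / ((D - 1) * (D + 2)))"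
    using integral_entangling_power[OF gO]
    unfolding s D_def[symmetric] C_def[symmetric] M_def[symmetric] .
  also have "(D - 2 ^ n / B) / M * C + ((D + 1) * (2 ^ n / B) - 2) =
      1 / B * (2 ^ n * (D + 1) - 2 * B + (B * D - 2 ^ n) / M * C)"
  proof -
    have "D - 2 ^ n / B = 1 / B * (B * D - 2 ^ n)" "(D + 1) * (2 ^ n / B) - 2 = 1 / B * (2 ^ n * (D + 1) - 2 * B)"
      using B by (simp_all add: field_simps)
    then show ?thesis by (simp only: distrib_left times_divide_eq_left times_divide_eq_right mult.assoc add.commute)
  qed
  finally show "(\<integral>U. entangling_power d n \<nu> U \<partial>\<mu>O) =
      2 * (1 - (\<Prod>i<n. 1 / (real (d i) + 1)) *
        ((2 ^ n * (constD d n + 1) - 2 * constB d n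
          + (constB d n * constD d n - 2 ^ n) / (2 ^ (n - 1) - 1) * constC d n) /
         ((constD d n - 1) * (constD d n + 2))))"
    unfolding invB times_divide_eq_right by (simp only: D_def B_def C_def M_def)
qed

end
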